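(* Let $\gamma,h>0$, $n\in\mathbb{N}$ with $n\ge 1$, and assume $U\colon\mathbb{R}^d\to\mathbb{R}$ is twice continuously differentiable with $L$-Lipschitz gradient $\nabla U$. Then for all $z,\tilde z\in\mathbb{R}^{2d}$, \[ d_{\mathrm{TV}}\bigl(\pi_n(\delta_z),\pi_n(\delta_{\tilde z})\bigr)\le \frac{1}{\gamma^{1/2}}\left[\frac{5}{(hn)^{3/2}}+\frac{12+5\gamma}{(hn)^{1/2}}+\frac{L(\gamma h)^{1/2}}{(1-e^{-\gamma h})^{1/2}}\left(1+\frac{hn}{1+\gamma hn}\right)(hn)^{1/2}\right]|\tilde z-z|. \]
   Context: Fix $d\ge 1$, $\gamma>0$, $h>0$ and $U\in C^2(\mathbb{R}^d)$. Write points of $\mathbb{R}^{2d}$ as $z=(x,v)$ with $x,v\in\mathbb{R}^d$; $|\cdot|$ is the Euclidean norm. For $z=(x,v)$ define the OBABO one-step map $\Psi_z\colon\mathbb{R}^{2d}\to\mathbb{R}^{2d}$, $\xi=(\xi^{(1)},\xi^{(2)})\in\mathbb{R}^d\times\mathbb{R}^d$, by $\Psi_z(\xi)=(\Psi^X_z(\xi^{(1)}),\Psi^V_z(\xi^{(1)},\xi^{(2)}))$ where $\Psi^X_z(\xi^{(1)})=x+he^{-\gamma h/2}v+(1-e^{-\gamma h})^{1/2}h\,\xi^{(1)}-\tfrac{h^2}{2}\nabla U(x)$ and $\Psi^V_z(\xi^{(1)},\xi^{(2)})=e^{-\gamma h}v+(1-e^{-\gamma h})^{1/2}(e^{-\gamma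 h/2}\xi^{(1)}+\xi^{(2)})-\tfrac h2 e^{-\gamma h/2}\bigl(\nabla U(x)+\nabla U(\Psi^X_z(\xi^{(1)}))\bigr)$. For $n\ge1$ define $\Psi^n_z\colon\mathbb{R}^{2dn}\to\mathbb{R}^{2d}$ by $\Psi^1_z=\Psi_z$ and $\Psi^{n+1}_z(\xi_1,\dots,\xi_{n+1})=\Psi_{\Psi^n_z(\xi_1,\dots,\xi_n)}(\xi_{n+1})$ (each $\xi_k\in\mathbb{R}^{2d}$), with the convention $\Psi^0_z\equiv z$. Let $\pi_n(\delta_z)$ denote the law of $\Psi^n_z(\xi)$ for $\xi\sim\mathcal N(0,I_{2dn})$ (the law after $n$ steps of the OBABO chain started at $z$), and for a probability measure $\nu$ on $\mathbb{R}^{2d}$ let $\pi_n(\nu)=\int\pi_n(\delta_z)\,\nu(dz)$. The total variation distance is $d_{\mathrm{TV}}(\mu,\nu)=\sup_A|\mu(A)-\nu(A)|$. *)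

theory Defs
  imports "HOL-Probability.Probability"
begin

definition std_gauss :: "'d::euclidean_space measure" where
  "std_gauss = density lborel
     (\<lambda>x. ennreal ((2 * pi) powr (- real DIM('d) / 2) * exp (- (norm x)\<^sup>2 / 2)))"

definition std_gauss2 :: "('d::euclidean_space \<times> 'd) measure" where
  "std_gauss2 = std_gauss \<Otimes>\<^sub>M std_gauss"

text \<open>OBABO one-step map; gU is the gradient of U.\<close>
definition PsiX :: "real \<Rightarrow> real \<Rightarrow> ('d::euclidean_space \<Rightarrow> 'd) \<Rightarrow> 'd \<times> 'd \<Rightarrow> 'd \<Rightarrow> 'd" where
  "PsiX \<gamma> h gU z xi1 =
     fst z + (h * exp (- \<gamma> * h / 2)) *\<^sub>R snd z
       + (sqrt (1 - exp (- \<gamma> * h)) * h) *\<^sub>R xi1 - (h\<^sup>2 / 2) *\<^sub>R gU (fst z)"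

definition PsiV :: "real \<Rightarrow> real \<Rightarrow> ('d::euclidean_space \<Rightarrow> 'd) \<Rightarrow> 'd \<times> 'd \<Rightarrow> 'd \<Rightarrow> 'd \<Rightarrow> 'd" where
  "PsiV \<gamma> h gU z xi1 xi2 =
     exp (- \<gamma> * h) *\<^sub>R snd z
       + sqrt (1 - exp (- \<gamma> * h)) *\<^sub>R (exp (- \<gamma> * h / 2) *\<^sub>R xi1 + xi2)
       - (h / 2 * exp (- \<gamma> * h / 2)) *\<^sub>R (gU (fst z) + gU (PsiX \<gamma> h gU z xi1))"

definition Psi :: "real \<Rightarrow> real \<Rightarrow> ('d::euclidean_space \<Rightarrow> 'd) \<Rightarrow> 'd \<times> 'd \<Rightarrow> 'd \<times> 'd \<Rightarrow> 'd \<times> 'd" where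
  "Psi \<gamma> h gU z xi = (PsiX \<gamma> h gU z (fst xi), PsiV \<gamma> h gU z (fst xi) (snd xi))"

fun PsiN :: "real \<Rightarrow> real \<Rightarrow> ('d::euclidean_space \<Rightarrow> 'd) \<Rightarrow> 'd \<times> 'd \<Rightarrow> nat \<Rightarrow> (nat \<Rightarrow> 'd \<times> 'd) \<Rightarrow> 'd \<times> 'd" where
  "PsiN \<gamma> h gU z 0 xi = z"
| "PsiN \<gamma> h gU z (Suc n) xi = Psi \<gamma> h gU (PsiN \<gamma> h gU z n xi) (xi n)"

definition piN :: "real \<Rightarrow> real \<Rightarrow> ('d::euclidean_space \<Rightarrow> 'd) \<Rightarrow> nat \<Rightarrow> 'd \<times> 'd \<Rightarrow> ('d \<times> 'd) measure" where
  "piN \<gamma> h gU n z = distr (PiM {..<n} (\<lambda>_. std_gauss2)) borel (PsiN \<gamma> h gU z n)"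

definition dTV :: "'a measure \<Rightarrow> 'a measure \<Rightarrow> real" where
  "dTV \<mu> \<nu> = (SUP A\<in>sets \<mu>. \<bar>measure \<mu> A - measure \<nu> A\<bar>)"

end

theory Submission
  imports Defs
begin

text \<open>Couple the chains started at \<open>z\<close> and \<open>z'\<close> by shifting the noise so that their difference
  follows a prescribed deterministic path from \<open>z' - z\<close> to \<open>0\<close> in \<open>n\<close> steps. The gradient
  terms are compensated exactly, and as the gradient is Lipschitz every shift is bounded by a
  constant \<open>W\<close>. The Hellinger affinity of the two laws is then at least
  \<open>exp (- n * W\<^sup>2 / 4)\<close>, which bounds their total variation distance by \<open>sqrt (n / 2) * W\<close>.
  The affinity \<open>\<alpha>\<close> of \<open>\<mu>\<close> and \<open>\<nu>\<close> is used only through its dual form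
  \<open>(\<integral> f d\<mu>) * (\<integral> 1 / f d\<nu>) \<ge> \<alpha>\<^sup>2\<close> for positive \<open>f\<close>, which passes through the
  steps of the Markov chains by induction and needs no densities on path space.\<close>

section \<open>Gaussian shifts\<close>

lemma space_std_gauss [simp]: "space std_gauss = UNIV"
  by (simp add: std_gauss_def)

lemma sets_std_gauss [simp, measurable_cong]: "sets std_gauss = sets borel"
  by (simp add: std_gauss_def)

text \<open>The density is the product over the coordinates of one-dimensional standard normal
  densities, so Tonelli reduces the total mass to the case of the real line.\<close>

lemma prob_space_std_gauss: "prob_space (std_gauss :: 'd::euclidean_space measure)"
proof
  have one: "(\<integral>\<^sup>+x. ennreal (std_normal_density x) \<partial>lborel) = 1"
    using prob_space.emeasure_space_1[OF prob_space_normal_density[of 1 0]]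
    by (simp add: emeasure_density)
  have dens: "(2 * pi) powr (- real DIM('d) / 2) * exp (- (norm x)\<^sup>2 / 2)
      = (\<Prod>b\<in>Basis. std_normal_density (x \<bullet> b))" for x :: 'd
  proof -
    have "(\<Prod>b\<in>Basis. std_normal_density (x \<bullet> b))
        = (1 / sqrt (2 * pi)) ^ DIM('d) * exp (\<Sum>b\<in>Basis. - (x \<bullet> b)\<^sup>2 / 2)"
      by (simp only: std_normal_density_def prod.distrib prod_constant exp_sum[OF finite_Basis])
    also have "(\<Sum>b\<in>Basis. - (x \<bullet> b)\<^sup>2 / 2) = - (norm x)\<^sup>2 / 2"
      unfolding power2_norm_eq_inner euclidean_inner[of x x]
      by (simp add: sum_negf sum_divide_distrib power2_eq_square)
    also have "(1 / sqrt (2 * pi)) ^ DIM('d) = (2 * pi) powr (- real DIM('d) / 2)"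
    proof -
      have "1 / sqrt (2 * pi) = (2 * pi) powr (- 1 / 2)"
        by (simp add: powr_minus powr_half_sqrt field_simps)
      then show ?thesis
        by (simp add: powr_power)
    qed
    finally show ?thesis by simp
  qed
  have "emeasure (std_gauss :: 'd measure) (space std_gauss)
      = (\<integral>\<^sup>+x. (\<Prod>b\<in>(Basis :: 'd set). ennreal (std_normal_density (x \<bullet> b))) \<partial>lborel)"
    unfolding std_gauss_def dens by (simp add: emeasure_density prod_ennreal)
  also have "\<dots> = 1"
    by (subst nn_integral_lborel_prod) (simp_all add: one)
  finally show "emeasure (std_gauss :: 'd measure) (space std_gauss) = 1" .
qed

interpretation std_gauss: prob_space "std_gauss :: 'd::euclidean_space measure"
  by (rule prob_space_std_gauss)

text \<open>The ratio of the standard Gaussian density at \<open>x + u\<close> to that at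
  \<open>x\<close>, that is, the Cameron-Martin factor of the translation by
  \<open>u\<close>.\<close>

definition gauss_weight :: "'d::euclidean_space \<Rightarrow> 'd \<Rightarrow> real" where
  "gauss_weight u x = exp (- (u \<bullet> x) - (norm u)\<^sup>2 / 2)"

lemma gauss_weight_measurable [measurable]: "gauss_weight u \<in> borel_measurable borel"
  unfolding gauss_weight_def[abs_def] by measurable

lemma gauss_weight_pos: "0 < gauss_weight u x"
  by (simp add: gauss_weight_def)

lemma nn_integral_std_gauss_shift:
  fixes u :: "'d::euclidean_space"
  assumes [measurable]: "H \<in> borel_measurable borel"
  shows "(\<integral>\<^sup>+x. ennreal (gauss_weight u x) * H (x + u) \<partial>std_gauss) = (\<integral>\<^sup>+x. H x \<partial>std_gauss)"
proof -
  let ?\<phi> = "\<lambda>x::'d. (2 * pi) powr (- real DIM('d) / 2) * exp (- (norm x)\<^sup>2 / 2)"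
  have w: "?\<phi> x * gauss_weight u x = ?\<phi> (u + x)" for x
  proof -
    have "- (norm x)\<^sup>2 / 2 + (- (u \<bullet> x) - (norm u)\<^sup>2 / 2) = - (norm (u + x))\<^sup>2 / 2"
      by (simp add: power2_norm_eq_inner inner_add_left inner_add_right inner_commute field_simps)
    then show ?thesis
      by (simp add: gauss_weight_def mult.assoc flip: exp_add)
  qed
  have "(\<integral>\<^sup>+x. H x \<partial>std_gauss) = (\<integral>\<^sup>+x. ennreal (?\<phi> x) * H x \<partial>lborel)"
    by (simp add: std_gauss_def nn_integral_density)
  also have "\<dots> = (\<integral>\<^sup>+x. ennreal (?\<phi> x) * H x \<partial>distr lborel borel ((+) u))"
    by (simp add: lborel_distr_plus)
  also have "\<dots> = (\<integral>\<^sup>+x. ennreal (?\<phi> (u + x)) * H (u + x) \<partial>lborel)"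
    by (subst nn_integral_distr) simp_all
  also have "\<dots> = (\<integral>\<^sup>+x. ennreal (?\<phi> x) * (ennreal (gauss_weight u x) * H (x + u)) \<partial>lborel)"
  proof (rule nn_integral_cong)
    fix x
    have "ennreal (?\<phi> (u + x)) = ennreal (?\<phi> x) * ennreal (gauss_weight u x)"
      by (subst w[symmetric], rule ennreal_mult) (simp_all add: gauss_weight_pos less_imp_le)
    then show "ennreal (?\<phi> (u + x)) * H (u + x)
        = ennreal (?\<phi> x) * (ennreal (gauss_weight u x) * H (x + u))"
      by (simp only: mult.assoc add.commute)
  qed
  also have "\<dots> = (\<integral>\<^sup>+x. ennreal (gauss_weight u x) * H (x + u) \<partial>std_gauss)"
    by (simp add: std_gauss_def nn_integral_density)
  finally show ?thesis ..
qed

section \<open>Test functions bounded above and away from zero\<close>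

text \<open>The uniform bounds make every integral against a probability measure finite and strictly
  positive, so quotients of such integrals can be formed, and they survive averaging over the
  noise.\<close>

definition pos_bounded :: "('a::topological_space \<Rightarrow> real) \<Rightarrow> bool" where
  "pos_bounded f \<longleftrightarrow> f \<in> borel_measurable borel \<and> (\<exists>c B. 0 < c \<and> (\<forall>x. c \<le> f x \<and> f x \<le> B))"

lemma pos_boundedI:
  assumes "f \<in> borel_measurable borel" "0 < c" "\<And>x. c \<le> f x" "\<And>x. f x \<le> B"
  shows "pos_bounded f"
  using assms unfolding pos_bounded_def by blast

lemma pos_boundedE:
  assumes "pos_bounded f"
  obtains c B where "f \<in> borel_measurable borel" "0 < c" "\<And>x. c \<le> f x" "\<And>x. f x \<le> B"
  using assms unfolding pos_bounded_def by blast

lemma (in prob_space) integrable_pos_bounded: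
  assumes "pos_bounded f" "g \<in> M \<rightarrow>\<^sub>M borel"
  shows "integrable M (\<lambda>x. f (g x))"
proof -
  obtain c B where f: "f \<in> borel_measurable borel" "0 < c" "\<And>x. c \<le> f x" "\<And>x. f x \<le> B"
    using assms(1) by (elim pos_boundedE) auto
  have "\<bar>f y\<bar> \<le> B" for y
    using f(2) f(3)[of y] f(4)[of y] by linarith
  then show ?thesis
    using f(1) assms(2) by (intro integrable_const_bound[where B=B]) auto
qed

text \<open>The constants that bound \<open>f\<close> also bound each of its averages. One step of a
  Markov chain thus maps test functions to test functions, as the induction over the steps
  requires.\<close>

lemma (in prob_space) pos_bounded_integral:
  assumes "pos_bounded f" "case_prod g \<in> borel \<Otimes>\<^sub>M M \<rightarrow>\<^sub>M borel"
  shows "pos_bounded (\<lambda>w. \<integral>x. f (g w x) \<partial>M)"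
proof -
  obtain c B where f: "f \<in> borel_measurable borel" "0 < c" "\<And>x. c \<le> f x" "\<And>x. f x \<le> B"
    using assms(1) by (elim pos_boundedE) auto
  have g: "g w \<in> M \<rightarrow>\<^sub>M borel" for w
    using measurable_compose[OF measurable_Pair1'[of w borel M] assms(2)] by simp
  note int = integrable_pos_bounded[OF assms(1) g]
  have "case_prod (\<lambda>w x. f (g w x)) \<in> borel_measurable (borel \<Otimes>\<^sub>M M)"
    using measurable_compose[OF assms(2) f(1)] by (simp add: case_prod_beta')
  moreover have "c \<le> (\<integral>x. f (g w x) \<partial>M)" for w
    by (rule integral_ge_const[OF int]) (simp add: f)
  moreover have "(\<integral>x. f (g w x) \<partial>M) \<le> B" for w
    by (rule integral_le_const[OF int]) (simp add: f)
  ultimately show ?thesis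
    using f(2) by (intro pos_boundedI[of _ c B] borel_measurable_lebesgue_integral) auto
qed

lemma integral_std_gauss_shift:
  assumes "H \<in> borel_measurable borel" "\<And>x. 0 \<le> H x"
  shows "(\<integral>x. gauss_weight u x * H (x + u) \<partial>std_gauss) = (\<integral>x. H x \<partial>std_gauss)"
proof -
  have [measurable]: "H \<in> borel_measurable borel" by fact
  show ?thesis
    using nn_integral_std_gauss_shift[of "\<lambda>x. ennreal (H x)" u] assms
    by (simp add: integral_eq_nn_integral gauss_weight_pos less_imp_le ennreal_mult'[symmetric])
qed

lemma integrable_std_gauss_shift:
  assumes "H \<in> borel_measurable borel" "\<And>x. 0 \<le> H x" "integrable std_gauss H"
  shows "integrable std_gauss (\<lambda>x. gauss_weight u x * H (x + u))"
proof -
  have [measurable]: "H \<in> borel_measurable borel" by fact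
  show ?thesis
    using nn_integral_std_gauss_shift[of "\<lambda>x. ennreal (H x)" u] assms
    by (intro integrableI_nonneg)
       (auto simp: gauss_weight_pos less_imp_le ennreal_mult'[symmetric] integrable_iff_bounded)
qed

section \<open>Affinity of a Gaussian and its translate\<close>

text \<open>Halving \<open>u\<close> halves the linear exponent but quarters the quadratic one. The
  discrepancy \<open>(norm u)\<^sup>2 / 8\<close> gives a constant factor, which is the Hellinger
  affinity of the Gaussian and its translate.\<close>

lemma sqrt_gauss_weight:
  "sqrt (gauss_weight u x) = gauss_weight ((1/2) *\<^sub>R u) x * exp (- (norm u)\<^sup>2 / 8)"
proof -
  have "gauss_weight u x = (gauss_weight ((1/2) *\<^sub>R u) x * exp (- (norm u)\<^sup>2 / 8))\<^sup>2"
    by (simp add: gauss_weight_def power_divide flip: exp_add exp_double)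
  then show ?thesis
    by (simp add: gauss_weight_pos less_imp_le)
qed

lemma integral_sqrt_gauss_weight:
  "integrable std_gauss (\<lambda>x. sqrt (gauss_weight u x))"
  "(\<integral>x. sqrt (gauss_weight u x) \<partial>std_gauss) = exp (- (norm u)\<^sup>2 / 8)"
  using integrable_std_gauss_shift[of "\<lambda>_. 1" "(1/2) *\<^sub>R u"]
    integral_std_gauss_shift[of "\<lambda>_. 1" "(1/2) *\<^sub>R u"]
  by (simp_all add: sqrt_gauss_weight std_gauss.prob_space[simplified])

text \<open>Cauchy-Schwarz bounds the integral of
  \<open>sqrt (F x * (gauss_weight u x * H (x + u)))\<close> by the root of the right-hand side,
  because the weight undoes the translation of \<open>H\<close>. From below this integral is at
  least \<open>sqrt \<kappa>\<close> times the affinity \<open>exp (- (norm u)\<^sup>2 / 8)\<close>;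
  squaring gives the claim.\<close>

lemma gauss_pair_bound:
  fixes u :: "'d::euclidean_space"
  assumes F: "pos_bounded F" and H: "pos_bounded H" and \<kappa>: "0 \<le> \<kappa>"
    and FH: "\<And>x. \<kappa> \<le> F x * H (x + u)"
  shows "\<kappa> * exp (- (norm u)\<^sup>2 / 4) \<le> (\<integral>x. F x \<partial>std_gauss) * (\<integral>x. H x \<partial>std_gauss)"
proof -
  define I where "I = (\<integral>x. F x \<partial>std_gauss)"
  define J where "J = (\<integral>x. H x \<partial>std_gauss)"
  obtain c B where f: "F \<in> borel_measurable borel" "0 < c" "\<And>x. c \<le> F x" "\<And>x. F x \<le> B"
    using F by (elim pos_boundedE) auto
  obtain c' B' where g: "H \<in> borel_measurable borel" "0 < c'" "\<And>x. c' \<le> H x" "\<And>x. H x \<le> B'"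
    using H by (elim pos_boundedE) auto
  have intF: "integrable std_gauss F" and intH: "integrable std_gauss H"
    using std_gauss.integrable_pos_bounded[of F "\<lambda>x. x"] std_gauss.integrable_pos_bounded[of H "\<lambda>x. x"] F H
    by auto
  have "c \<le> I" unfolding I_def by (rule std_gauss.integral_ge_const[OF intF]) (simp add: f)
  then have I: "0 < I" using f by simp
  have "c' \<le> J" unfolding J_def by (rule std_gauss.integral_ge_const[OF intH]) (simp add: g)
  then have J: "0 < J" using g by simp
  have H0: "0 \<le> H x" for x using g(2) g(3)[of x] by simp
  have F0: "0 \<le> F x" for x using f(2) f(3)[of x] by simp
  note wH = integrable_std_gauss_shift[OF g(1) H0 intH, of u]
  \<comment> \<open>Cauchy-Schwarz is derived from the arithmetic-geometric mean inequality; this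
    \<open>\<rho>\<close> minimises \<open>\<rho> * I + J / \<rho>\<close>, with minimum
    \<open>2 * sqrt (I * J)\<close>.\<close>
  define \<rho> where "\<rho> = sqrt (J / I)"
  have \<rho>: "0 < \<rho>" using I J by (simp add: \<rho>_def)
  have pt: "2 * (sqrt \<kappa> * sqrt (gauss_weight u x)) \<le> \<rho> * F x + (gauss_weight u x * H (x + u)) / \<rho>" for x
  proof -
    let ?a = "\<rho> * F x" and ?b = "(gauss_weight u x * H (x + u)) / \<rho>"
    have "sqrt \<kappa> * sqrt (gauss_weight u x) \<le> sqrt (?a * ?b)"
      using FH[of x] \<rho> mult_right_mono[OF FH[of x], of "gauss_weight u x"]
      by (simp add: gauss_weight_pos less_imp_le mult.assoc mult.left_commute mult.commute
          flip: real_sqrt_mult)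
    also have "\<dots> \<le> (?a + ?b) / 2"
      using F0[of x] H0[of "x + u"] \<rho>
      by (intro arith_geo_mean_sqrt) (auto simp: gauss_weight_pos less_imp_le)
    finally show ?thesis by simp
  qed
  have "2 * (sqrt \<kappa> * exp (- (norm u)\<^sup>2 / 8))
      = (\<integral>x. 2 * (sqrt \<kappa> * sqrt (gauss_weight u x)) \<partial>std_gauss)"
    by (simp add: integral_sqrt_gauss_weight)
  also have "\<dots> \<le> (\<integral>x. \<rho> * F x + (gauss_weight u x * H (x + u)) / \<rho> \<partial>std_gauss)"
    using pt by (intro integral_mono) (auto simp: integral_sqrt_gauss_weight intF wH)
  also have "\<dots> = \<rho> * I + J / \<rho>"
    using integral_std_gauss_shift[OF g(1) H0] by (simp add: intF wH I_def J_def)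
  also have "\<dots> = 2 * sqrt (I * J)"
    using I J by (simp add: \<rho>_def real_sqrt_divide real_sqrt_mult field_simps flip: power2_eq_square)
  finally have "sqrt \<kappa> * exp (- (norm u)\<^sup>2 / 8) \<le> sqrt (I * J)" by simp
  then have "(sqrt \<kappa> * exp (- (norm u)\<^sup>2 / 8))\<^sup>2 \<le> (sqrt (I * J))\<^sup>2"
    using \<kappa> by (intro power_mono) auto
  then show ?thesis
    using I J \<kappa> by (simp add: power_mult_distrib I_def J_def flip: exp_double)
qed

lemma prob_space_std_gauss2: "prob_space (std_gauss2 :: ('d::euclidean_space \<times> 'd) measure)"
proof -
  interpret pair_prob_space "std_gauss :: 'd measure" "std_gauss :: 'd measure" ..
  show ?thesis
    unfolding std_gauss2_def by (rule P.prob_space_axioms)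
qed

interpretation std_gauss2: prob_space "std_gauss2 :: ('d::euclidean_space \<times> 'd) measure"
  by (rule prob_space_std_gauss2)

lemma sets_std_gauss2 [simp, measurable_cong]:
  "sets (std_gauss2 :: ('d::euclidean_space \<times> 'd) measure) = sets borel"
  unfolding std_gauss2_def borel_prod[symmetric] by (intro sets_pair_measure_cong) simp_all

lemma integral_std_gauss2:
  fixes f :: "'d::euclidean_space \<times> 'd \<Rightarrow> real"
  assumes "integrable std_gauss2 f"
  shows "(\<integral>x. f x \<partial>std_gauss2) = (\<integral>x. (\<integral>y. f (x, y) \<partial>std_gauss) \<partial>std_gauss)"
proof -
  interpret pair_sigma_finite "std_gauss :: 'd measure" "std_gauss :: 'd measure" ..
  show ?thesis
    using integral_fst'[of f] assms by (simp add: std_gauss2_def)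
qed

section \<open>Coupling of two OBABO chains\<close>

locale obabo =
  fixes \<gamma> h :: real and gU :: "'d::euclidean_space \<Rightarrow> 'd"
  assumes gamma_pos: "0 < \<gamma>" and h_pos: "0 < h" and continuous_gU: "continuous_on UNIV gU"
begin

text \<open>\<open>q\<close> is the velocity damping of one O half step and \<open>\<sigma>\<close>
  its noise amplitude, with \<open>q\<^sup>2 + \<sigma>\<^sup>2 = 1\<close>.\<close>

definition q :: real where "q = exp (- (\<gamma> * h) / 2)"

definition \<sigma> :: real where "\<sigma> = sqrt (1 - q\<^sup>2)"

lemma q_pos: "0 < q" and q_less_1: "q < 1"
  using gamma_pos h_pos by (simp_all add: q_def)

lemma q_square: "q\<^sup>2 = exp (- (\<gamma> * h))"
  by (simp add: q_def flip: exp_double)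

lemma sigma_pos: "0 < \<sigma>"
  using q_pos q_less_1 by (simp add: \<sigma>_def power_less_one_iff)

lemma PsiX_alt: "PsiX \<gamma> h gU z \<xi> = fst z + (h * q) *\<^sub>R snd z + (h * \<sigma>) *\<^sub>R \<xi> - (h\<^sup>2 / 2) *\<^sub>R gU (fst z)"
  by (simp add: PsiX_def q_square \<sigma>_def mult.commute) (simp add: q_def mult.commute)

lemma PsiV_alt: "PsiV \<gamma> h gU z \<xi> \<xi>' = q\<^sup>2 *\<^sub>R snd z + \<sigma> *\<^sub>R (q *\<^sub>R \<xi> + \<xi>')
    - (h / 2 * q) *\<^sub>R (gU (fst z) + gU (PsiX \<gamma> h gU z \<xi>))"
  by (simp add: PsiV_def q_square \<sigma>_def) (simp add: q_def)

lemma continuous_Psi: "continuous_on UNIV (\<lambda>(z, \<xi>). Psi \<gamma> h gU z \<xi>)"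
proof -
  have gU: "continuous_on UNIV (\<lambda>x. gU (f x))" if "continuous_on UNIV f"
    for f :: "('d \<times> 'd) \<times> ('d \<times> 'd) \<Rightarrow> 'd"
    using continuous_on_compose2[OF continuous_gU that] by simp
  show ?thesis
    unfolding Psi_def PsiX_alt PsiV_alt case_prod_beta'
    by (intro continuous_intros gU)
qed

lemma measurable_Psi: "(\<lambda>(z, \<xi>). Psi \<gamma> h gU z \<xi>) \<in> borel \<Otimes>\<^sub>M std_gauss2 \<rightarrow>\<^sub>M borel"
proof -
  have "sets (borel \<Otimes>\<^sub>M (std_gauss2 :: ('d \<times> 'd) measure))
      = sets (borel :: (('d \<times> 'd) \<times> ('d \<times> 'd)) measure)"
    unfolding borel_prod[symmetric, where 'a="'d \<times> 'd" and 'b="'d \<times> 'd"]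
    by (intro sets_pair_measure_cong) simp_all
  then show ?thesis
    using borel_measurable_continuous_onI[OF continuous_Psi]
    by (simp cong: measurable_cong_sets)
qed

lemma measurable_Psi_right: "Psi \<gamma> h gU z \<in> std_gauss2 \<rightarrow>\<^sub>M borel"
  using measurable_compose[OF measurable_Pair1'[of z borel std_gauss2] measurable_Psi] by simp

lemma measurable_Psi_noise: "(\<lambda>(\<xi>, \<xi>'). Psi \<gamma> h gU z (\<xi>, \<xi>')) \<in> borel \<Otimes>\<^sub>M std_gauss \<rightarrow>\<^sub>M borel"
proof -
  have "sets (borel \<Otimes>\<^sub>M (std_gauss :: 'd measure)) = sets (std_gauss2 :: ('d \<times> 'd) measure)"
    unfolding std_gauss2_def by (intro sets_pair_measure_cong) simp_all
  then show ?thesis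
    using measurable_Psi_right[of z] by (simp cong: measurable_cong_sets)
qed

lemma integral_Psi:
  assumes "pos_bounded f"
  shows "(\<integral>\<xi>. f (Psi \<gamma> h gU z \<xi>) \<partial>std_gauss2)
    = (\<integral>\<xi>. (\<integral>\<xi>'. f (Psi \<gamma> h gU z (\<xi>, \<xi>')) \<partial>std_gauss) \<partial>std_gauss)"
  by (intro integral_std_gauss2 std_gauss2.integrable_pos_bounded assms measurable_Psi_right)

text \<open>The shifts of the noise are chosen so that the two chains keep a prescribed deterministic
  difference. As this difference does not depend on the noise, the shift of each Gaussian
  variable depends only on the variables drawn before it.\<close>

lemma Psi_shift:
  assumes u: "\<sigma> *\<^sub>R u = D - q *\<^sub>R b + (h / 2) *\<^sub>R (gU (x + a) - gU x)"
    and X: "X = PsiX \<gamma> h gU (x, v) \<xi>"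
    and u': "\<sigma> *\<^sub>R u' = b' - q *\<^sub>R D + (h / 2 * q) *\<^sub>R (gU (X + (a + h *\<^sub>R D)) - gU X)"
  shows "Psi \<gamma> h gU ((x, v) + (a, b)) (\<xi> + u, \<xi>' + u')
    = Psi \<gamma> h gU (x, v) (\<xi>, \<xi>') + (a + h *\<^sub>R D, b')"
proof -
  have "PsiX \<gamma> h gU (x + a, v + b) (\<xi> + u)
      = x + a + (h * q) *\<^sub>R (v + b) + (h * \<sigma>) *\<^sub>R \<xi> + h *\<^sub>R (\<sigma> *\<^sub>R u) - (h\<^sup>2 / 2) *\<^sub>R gU (x + a)"
    by (simp add: PsiX_alt scaleR_add_right)
  also have "\<dots> = X + (a + h *\<^sub>R D)"
    unfolding u X by (simp add: PsiX_alt algebra_simps power2_eq_square)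
  finally have X': "PsiX \<gamma> h gU (x + a, v + b) (\<xi> + u) = X + (a + h *\<^sub>R D)" .
  have "PsiV \<gamma> h gU (x + a, v + b) (\<xi> + u) (\<xi>' + u')
      = q\<^sup>2 *\<^sub>R (v + b) + \<sigma> *\<^sub>R (q *\<^sub>R \<xi> + \<xi>') + q *\<^sub>R (\<sigma> *\<^sub>R u) + \<sigma> *\<^sub>R u'
        - (h / 2 * q) *\<^sub>R (gU (x + a) + gU (X + (a + h *\<^sub>R D)))"
    unfolding PsiV_alt X' by (simp add: scaleR_add_right mult.commute)
  also have "\<dots> = PsiV \<gamma> h gU (x, v) \<xi> \<xi>' + b'"
    unfolding u u' PsiV_alt X[symmetric]
    by (simp add: algebra_simps power2_eq_square)
  finally show ?thesis
    using X' X by (simp add: Psi_def)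
qed

text \<open>The Gaussian bound is applied once to each of the two noise variables of a step, and
  each application costs a factor \<open>exp (- W\<^sup>2 / 4)\<close>. The second variable is
  integrated first, since its shift depends on the first.\<close>

lemma Psi_pair_bound:
  assumes f: "pos_bounded f" and f': "pos_bounded f'" and \<kappa>: "0 \<le> \<kappa>"
    and ff': "\<And>w. \<kappa> \<le> f w * f' (w + (a + h *\<^sub>R D, b'))"
    and W: "\<And>x. norm (D - q *\<^sub>R b + (h / 2) *\<^sub>R (gU (x + a) - gU x)) \<le> \<sigma> * W"
    and W': "\<And>x. norm (b' - q *\<^sub>R D + (h / 2 * q) *\<^sub>R (gU (x + (a + h *\<^sub>R D)) - gU x)) \<le> \<sigma> * W"
  shows "\<kappa> * exp (- W\<^sup>2 / 2) \<le> (\<integral>\<xi>. f (Psi \<gamma> h gU w \<xi>) \<partial>std_gauss2)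
    * (\<integral>\<xi>. f' (Psi \<gamma> h gU (w + (a, b)) \<xi>) \<partial>std_gauss2)"
proof -
  obtain x v where w: "w = (x, v)" by (cases w)
  define u where "u = (1 / \<sigma>) *\<^sub>R (D - q *\<^sub>R b + (h / 2) *\<^sub>R (gU (x + a) - gU x))"
  have u: "\<sigma> *\<^sub>R u = D - q *\<^sub>R b + (h / 2) *\<^sub>R (gU (x + a) - gU x)"
    using sigma_pos by (simp add: u_def)
  have normI: "\<kappa> * exp (- W\<^sup>2 / 4) \<le> \<kappa> * exp (- (norm y)\<^sup>2 / 4)"
    if "norm (\<sigma> *\<^sub>R y) \<le> \<sigma> * W" "0 \<le> \<kappa>" for y :: 'd and \<kappa> :: real
  proof -
    have "norm y \<le> W" using that sigma_pos by simp
    then have "(norm y)\<^sup>2 \<le> W\<^sup>2" by (intro power_mono) auto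
    then show ?thesis using that by (intro mult_left_mono) auto
  qed
  define F where "F = (\<lambda>\<xi>. \<integral>\<xi>'. f (Psi \<gamma> h gU w (\<xi>, \<xi>')) \<partial>std_gauss)"
  define F' where "F' = (\<lambda>\<xi>. \<integral>\<xi>'. f' (Psi \<gamma> h gU (w + (a, b)) (\<xi>, \<xi>')) \<partial>std_gauss)"
  have F: "pos_bounded F" "pos_bounded F'"
    unfolding F_def F'_def
    by (intro std_gauss.pos_bounded_integral f f' measurable_Psi_noise)+
  have g: "pos_bounded (\<lambda>\<xi>'. f (Psi \<gamma> h gU y (\<xi>, \<xi>')))"
    if "pos_bounded f" for f y \<xi>
  proof -
    have "(\<lambda>\<xi>'. Psi \<gamma> h gU y (\<xi>, \<xi>')) \<in> borel_measurable borel"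
      using measurable_compose[OF measurable_Pair1'[of \<xi> borel std_gauss] measurable_Psi_noise[of y]]
      by (simp cong: measurable_cong_sets)
    then show ?thesis
      using that measurable_compose[of "\<lambda>\<xi>'. Psi \<gamma> h gU y (\<xi>, \<xi>')" borel borel f]
      unfolding pos_bounded_def by blast
  qed
  \<comment> \<open>For a fixed first noise \<open>\<xi>\<close> the shift \<open>u'\<close> is a
    constant. The resulting inner bound is the pointwise hypothesis of the outer one, with
    \<open>\<kappa> * exp (- W\<^sup>2 / 4)\<close> in place of \<open>\<kappa>\<close>.\<close>
  have "\<kappa> * exp (- W\<^sup>2 / 4) \<le> F \<xi> * F' (\<xi> + u)" for \<xi>
  proof -
    define X where "X = PsiX \<gamma> h gU (x, v) \<xi>"
    define u' where
      "u' = (1 / \<sigma>) *\<^sub>R (b' - q *\<^sub>R D + (h / 2 * q) *\<^sub>R (gU (X + (a + h *\<^sub>R D)) - gU X))"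
    have u': "\<sigma> *\<^sub>R u' = b' - q *\<^sub>R D + (h / 2 * q) *\<^sub>R (gU (X + (a + h *\<^sub>R D)) - gU X)"
      using sigma_pos by (simp add: u'_def)
    have "\<kappa> * exp (- W\<^sup>2 / 4) \<le> \<kappa> * exp (- (norm u')\<^sup>2 / 4)"
      using W' \<kappa> by (intro normI) (auto simp only: u')
    also have "\<dots> \<le> F \<xi> * F' (\<xi> + u)"
      unfolding F_def F'_def
    proof (rule gauss_pair_bound[OF g[OF f] g[OF f'] \<kappa>])
      fix \<xi>'
      show "\<kappa> \<le> f (Psi \<gamma> h gU w (\<xi>, \<xi>')) * f' (Psi \<gamma> h gU (w + (a, b)) (\<xi> + u, \<xi>' + u'))"
        unfolding w Psi_shift[OF u X_def u'] by (rule ff')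
    qed
    finally show ?thesis .
  qed
  then have "\<kappa> * exp (- W\<^sup>2 / 4) * exp (- (norm u)\<^sup>2 / 4)
      \<le> (\<integral>\<xi>. F \<xi> \<partial>std_gauss) * (\<integral>\<xi>. F' \<xi> \<partial>std_gauss)"
    using \<kappa> by (intro gauss_pair_bound F) auto
  moreover have "\<kappa> * exp (- W\<^sup>2 / 4) * exp (- W\<^sup>2 / 4)
      \<le> \<kappa> * exp (- W\<^sup>2 / 4) * exp (- (norm u)\<^sup>2 / 4)"
    using W \<kappa> by (intro normI) (auto simp only: u zero_le_mult_iff exp_ge_zero)
  ultimately show ?thesis
    unfolding integral_Psi[OF f] integral_Psi[OF f'] F_def F'_def
    by (simp add: mult.assoc flip: exp_add)
qed

section \<open>Iteration over the steps of the chain\<close>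

text \<open>The product may have more factors than there are steps, so that one space serves
  throughout the induction on \<open>n\<close>.\<close>

lemma measurable_PsiN:
  "n \<le> m \<Longrightarrow> PsiN \<gamma> h gU z n \<in> PiM {..<m} (\<lambda>_. std_gauss2) \<rightarrow>\<^sub>M borel"
proof (induction n)
  case 0
  have "PsiN \<gamma> h gU z 0 = (\<lambda>_. z)" by (simp add: fun_eq_iff)
  then show ?case by simp
next
  case (Suc n)
  have "(\<lambda>\<xi>. (PsiN \<gamma> h gU z n \<xi>, \<xi> n)) \<in> PiM {..<m} (\<lambda>_. std_gauss2) \<rightarrow>\<^sub>M borel \<Otimes>\<^sub>M std_gauss2"
    using Suc by (intro measurable_Pair measurable_component_singleton) auto
  from measurable_compose[OF this measurable_Psi] show ?case
    by (simp add: fun_eq_iff[of "PsiN \<gamma> h gU z (Suc n)"] cong: measurable_cong)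
qed

lemma PsiN_fun_upd: "n \<le> m \<Longrightarrow> PsiN \<gamma> h gU z n (\<xi>(m := y)) = PsiN \<gamma> h gU z n \<xi>"
  by (induction n) auto

text \<open>The first \<open>n\<close> steps do not see coordinate \<open>n\<close> of the noise, so
  Fubini splits off the last step.\<close>

lemma integral_PsiN_Suc:
  assumes f: "pos_bounded f"
  shows "(\<integral>\<xi>. f (PsiN \<gamma> h gU z (Suc n) \<xi>) \<partial>PiM {..<Suc n} (\<lambda>_. std_gauss2))
    = (\<integral>\<xi>. (\<integral>\<eta>. f (Psi \<gamma> h gU (PsiN \<gamma> h gU z n \<xi>) \<eta>) \<partial>std_gauss2) \<partial>PiM {..<n} (\<lambda>_. std_gauss2))"
proof -
  interpret P: product_sigma_finite "\<lambda>_::nat. std_gauss2 :: ('d \<times> 'd) measure" ..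
  interpret prob_space "PiM {..<Suc n} (\<lambda>_. std_gauss2 :: ('d \<times> 'd) measure)"
    by (intro prob_space_PiM std_gauss2.prob_space_axioms)
  have "integrable (PiM (insert n {..<n}) (\<lambda>_. std_gauss2)) (\<lambda>\<xi>. f (PsiN \<gamma> h gU z (Suc n) \<xi>))"
    using integrable_pos_bounded[OF f measurable_PsiN[of "Suc n" "Suc n" z]] by (simp add: lessThan_Suc)
  from P.product_integral_insert[OF _ _ this] show ?thesis
    by (simp add: lessThan_Suc PsiN_fun_upd)
qed

text \<open>The induction removes the last step: averaging over its noise turns \<open>f\<close> and
  \<open>f'\<close> into new test functions at time \<open>n\<close>, and the one-step bound
  replaces \<open>\<kappa>\<close> by \<open>\<kappa> * exp (- W\<^sup>2 / 2)\<close>. Hence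
  \<open>f\<close>, \<open>f'\<close> and \<open>\<kappa>\<close> have to be arbitrary.\<close>

lemma PsiN_pair_bound:
  assumes a: "\<And>k. k < n \<Longrightarrow> a (Suc k) = a k + h *\<^sub>R D k"
    and W: "\<And>k x. k < n \<Longrightarrow> norm (D k - q *\<^sub>R b k + (h / 2) *\<^sub>R (gU (x + a k) - gU x)) \<le> \<sigma> * W"
    and W': "\<And>k x. k < n \<Longrightarrow>
      norm (b (Suc k) - q *\<^sub>R D k + (h / 2 * q) *\<^sub>R (gU (x + a (Suc k)) - gU x)) \<le> \<sigma> * W"
    and f: "pos_bounded f" and f': "pos_bounded f'" and \<kappa>: "0 \<le> \<kappa>"
    and ff': "\<And>w. \<kappa> \<le> f w * f' (w + (a n, b n))"
  shows "\<kappa> * exp (- real n * W\<^sup>2 / 2)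
    \<le> (\<integral>\<xi>. f (PsiN \<gamma> h gU z n \<xi>) \<partial>PiM {..<n} (\<lambda>_. std_gauss2))
      * (\<integral>\<xi>. f' (PsiN \<gamma> h gU (z + (a 0, b 0)) n \<xi>) \<partial>PiM {..<n} (\<lambda>_. std_gauss2))"
  using assms
proof (induction n arbitrary: f f' \<kappa>)
  case 0
  interpret prob_space "PiM {..<0::nat} (\<lambda>_. std_gauss2 :: ('d \<times> 'd) measure)"
    by (intro prob_space_PiM std_gauss2.prob_space_axioms)
  show ?case using 0 by (simp add: prob_space[simplified])
next
  case (Suc n)
  let ?P = "\<lambda>f w. \<integral>\<eta>. f (Psi \<gamma> h gU w \<eta>) \<partial>std_gauss2"
  have P: "pos_bounded (?P f)" "pos_bounded (?P f')"
    by (intro std_gauss2.pos_bounded_integral Suc.prems measurable_Psi)+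
  have "\<kappa> * exp (- W\<^sup>2 / 2) \<le> ?P f w * ?P f' (w + (a n, b n))" for w
    using Suc.prems by (intro Psi_pair_bound[where D="D n" and b'="b (Suc n)"]) auto
  from Suc.IH[OF _ _ _ P _ this] Suc.prems
  have "\<kappa> * exp (- W\<^sup>2 / 2) * exp (- real n * W\<^sup>2 / 2)
    \<le> (\<integral>\<xi>. ?P f (PsiN \<gamma> h gU z n \<xi>) \<partial>PiM {..<n} (\<lambda>_. std_gauss2))
      * (\<integral>\<xi>. ?P f' (PsiN \<gamma> h gU (z + (a 0, b 0)) n \<xi>) \<partial>PiM {..<n} (\<lambda>_. std_gauss2))"
    by simp
  moreover have "\<kappa> * exp (- W\<^sup>2 / 2) * exp (- real n * W\<^sup>2 / 2) = \<kappa> * exp (- real (Suc n) * W\<^sup>2 / 2)"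
    by (simp add: algebra_simps add_divide_distrib flip: exp_add)
  ultimately show ?case
    by (simp only: integral_PsiN_Suc Suc.prems)
qed

end

section \<open>From affinity to total variation\<close>

text \<open>The test function here is \<open>t\<close> on an event and \<open>1\<close> off it. The
  infimum over \<open>t\<close> is the square of the affinity
  \<open>sqrt (p * p') + sqrt ((1 - p) * (1 - p'))\<close> of two Bernoulli laws, so
  \<open>\<alpha>\<close> is a lower bound for a squared affinity. What remains is the classical
  comparison of total variation with affinity.\<close>

lemma bernoulli_affinity_bound:
  fixes p p' \<alpha> :: real
  assumes p: "0 \<le> p" "p \<le> 1" "0 \<le> p'" "p' \<le> 1"
    and bound: "\<And>t. 0 < t \<Longrightarrow> \<alpha> \<le> (p * t + (1 - p)) * (p' / t + (1 - p'))"
  shows "(p - p')\<^sup>2 \<le> 1 - \<alpha>"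
proof -
  define c m k where "c = p * p' + (1 - p) * (1 - p')" and "m = p * (1 - p')" and "k = p' * (1 - p)"
  have mk: "0 \<le> m" "0 \<le> k" using p by (auto simp: m_def k_def)
  have t: "\<alpha> \<le> c + m * t + k / t" if "0 < t" for t
    using bound[OF that] that by (simp add: c_def m_def k_def field_simps)
  have c: "c = 1 - (m + k)" and d: "p - p' = m - k"
    by (simp_all add: c_def m_def k_def algebra_simps)
  have mk1: "m + k \<le> 1"
  proof -
    have "0 \<le> c" using p by (simp add: c_def)
    then show ?thesis using c by simp
  qed
  have "\<alpha> \<le> c + 2 * sqrt (m * k)"
  \<comment> \<open>For positive \<open>m\<close> and \<open>k\<close> the optimal \<open>t\<close>
    is \<open>sqrt (k / m)\<close>. If one of them is \<open>0\<close>, the infimum may only be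
    approached as \<open>t\<close> tends to infinity or to \<open>0\<close>, hence the slack
    \<open>e\<close>.\<close>
  proof (rule field_le_epsilon)
    fix e :: real assume e: "0 < e"
    show "\<alpha> \<le> c + 2 * sqrt (m * k) + e"
    proof (cases "m = 0 \<or> k = 0")
      case True
      then consider "m = 0" | "k = 0" by blast
      then show ?thesis
      proof cases
        case 1
        have "k * e \<le> 1 * e" using mk1 1 e by (intro mult_right_mono) auto
        moreover have "\<alpha> \<le> c + k * e" using t[of "1 / e"] e 1 by simp
        ultimately show ?thesis using 1 by simp
      next
        case 2
        have "m * e \<le> 1 * e" using mk1 2 e by (intro mult_right_mono) auto
        moreover have "\<alpha> \<le> c + m * e" using t[of e] e 2 by simp
        ultimately show ?thesis using 2 by simp
      qed
    next
      case False
      then have pos: "0 < m" "0 < k" using mk by auto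
      have "m * sqrt (k / m) + k / sqrt (k / m) = 2 * sqrt (m * k)"
        using pos by (simp add: real_sqrt_divide real_sqrt_mult field_simps flip: power2_eq_square)
      then show ?thesis using t[of "sqrt (k / m)"] pos e by simp
    qed
  qed
  moreover have "c + 2 * sqrt (m * k) \<le> 1 - (m - k)\<^sup>2"
  proof -
    define r s where "r = sqrt m" and "s = sqrt k"
    have rs: "m = r\<^sup>2" "k = s\<^sup>2" "sqrt (m * k) = r * s" "0 \<le> r" "0 \<le> s"
      using mk by (simp_all add: r_def s_def real_sqrt_mult)
    \<comment> \<open>The bound to show is \<open>(r - s)\<^sup>2 * (1 - (r + s)\<^sup>2) \<ge> 0\<close>, so \<open>(r + s)\<^sup>2 \<le> 1\<close> is needed.\<close>
    have "(r + s)\<^sup>2 \<le> 1"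
    proof -
      have "r = sqrt p * sqrt (1 - p')" "s = sqrt p' * sqrt (1 - p)"
        by (simp_all add: r_def s_def m_def k_def real_sqrt_mult)
      \<comment> \<open>This square and \<open>(r + s)\<^sup>2\<close> add up to \<open>1\<close>:
        their cross terms cancel, and the other terms sum to
        \<open>(p + (1 - p)) * (p' + (1 - p'))\<close>.\<close>
      moreover have "0 \<le> (sqrt p * sqrt p' - sqrt (1 - p) * sqrt (1 - p'))\<^sup>2" by simp
      ultimately show ?thesis
        using p by (simp add: power2_sum power2_diff power_mult_distrib) (simp add: algebra_simps)
    qed
    then have "0 \<le> (r - s)\<^sup>2 * (1 - (r + s)\<^sup>2)" by simp
    then show ?thesis
      unfolding c rs(3) unfolding rs(1,2)
      by (simp add: algebra_simps power2_eq_square)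
  qed
  ultimately show ?thesis unfolding d by simp
qed

context obabo
begin

lemma integral_PsiN_two_valued:
  assumes A: "A \<in> sets borel"
  shows "(\<integral>\<xi>. (if PsiN \<gamma> h gU z n \<xi> \<in> A then t else 1) \<partial>PiM {..<n} (\<lambda>_. std_gauss2))
    = measure (piN \<gamma> h gU n z) A * t + (1 - measure (piN \<gamma> h gU n z) A)"
proof -
  let ?P = "PiM {..<n} (\<lambda>_. std_gauss2 :: ('d \<times> 'd) measure)"
  interpret prob_space ?P by (intro prob_space_PiM std_gauss2.prob_space_axioms)
  have [measurable]: "PsiN \<gamma> h gU z n \<in> ?P \<rightarrow>\<^sub>M borel" "A \<in> sets borel"
    using measurable_PsiN A by auto
  interpret \<pi>: prob_space "piN \<gamma> h gU n z"
    unfolding piN_def by (intro prob_space_distr) simp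
  have A': "A \<in> sets (piN \<gamma> h gU n z)" using A by (simp add: piN_def)
  have "(\<integral>\<xi>. (if PsiN \<gamma> h gU z n \<xi> \<in> A then t else 1) \<partial>?P)
      = (\<integral>w. (if w \<in> A then t else 1) \<partial>piN \<gamma> h gU n z)"
    unfolding piN_def by (subst integral_distr) simp_all
  also have "\<dots> = (\<integral>w. indicator A w * (t - 1) + 1 \<partial>piN \<gamma> h gU n z)"
    by (intro Bochner_Integration.integral_cong) (auto simp: indicator_def)
  also have "\<dots> = measure (piN \<gamma> h gU n z) A * (t - 1) + 1"
  proof -
    have "integrable (piN \<gamma> h gU n z) (indicator A :: _ \<Rightarrow> real)"
      using A' by (intro integrable_real_indicator) (auto simp: \<pi>.emeasure_eq_measure)
    then show ?thesis
      using A' by (simp add: \<pi>.prob_space)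
  qed
  finally show ?thesis by (simp add: algebra_simps)
qed

text \<open>Since the difference path ends in \<open>0\<close>, a test function equal to
  \<open>t\<close> on \<open>A\<close> and \<open>1\<close> elsewhere can be paired with its
  reciprocal, which gives \<open>\<kappa> = 1\<close>. The Bernoulli bound and
  \<open>1 - exp (- y) \<le> y\<close> then finish the estimate.\<close>

lemma dTV_piN_le:
  assumes a: "\<And>k. k < n \<Longrightarrow> a (Suc k) = a k + h *\<^sub>R D k"
    and W: "\<And>k x. k < n \<Longrightarrow> norm (D k - q *\<^sub>R b k + (h / 2) *\<^sub>R (gU (x + a k) - gU x)) \<le> \<sigma> * W"
    and W': "\<And>k x. k < n \<Longrightarrow>
      norm (b (Suc k) - q *\<^sub>R D k + (h / 2 * q) *\<^sub>R (gU (x + a (Suc k)) - gU x)) \<le> \<sigma> * W"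
    and end0: "a n = 0" "b n = 0" and W0: "0 \<le> W"
  shows "dTV (piN \<gamma> h gU n z) (piN \<gamma> h gU n (z + (a 0, b 0))) \<le> sqrt (real n / 2) * W"
  unfolding dTV_def
proof (rule cSUP_least)
  fix A assume "A \<in> sets (piN \<gamma> h gU n z)"
  then have A: "A \<in> sets borel" by (simp add: piN_def)
  define p where "p z = measure (piN \<gamma> h gU n z) A" for z
  have p01: "0 \<le> p z" "p z \<le> 1" for z
  proof -
    interpret prob_space "PiM {..<n} (\<lambda>_. std_gauss2 :: ('d \<times> 'd) measure)"
      by (intro prob_space_PiM std_gauss2.prob_space_axioms)
    interpret \<pi>: prob_space "piN \<gamma> h gU n z"
      unfolding piN_def by (intro prob_space_distr measurable_PsiN) simp
    show "0 \<le> p z" "p z \<le> 1" by (simp_all add: p_def)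
  qed
  let ?z' = "z + (a 0, b 0)"
  have pb: "pos_bounded (\<lambda>w. if w \<in> A then t else 1 :: real)" if "0 < t" for t
    using that A by (intro pos_boundedI[of _ "min t 1" "max t 1"]) auto
  have "exp (- real n * W\<^sup>2 / 2) \<le> (p z * t + (1 - p z)) * (p ?z' / t + (1 - p ?z'))"
    if t: "0 < t" for t
  proof -
    have "1 * exp (- real n * W\<^sup>2 / 2)
      \<le> (\<integral>\<xi>. (if PsiN \<gamma> h gU z n \<xi> \<in> A then t else 1) \<partial>PiM {..<n} (\<lambda>_. std_gauss2))
        * (\<integral>\<xi>. (if PsiN \<gamma> h gU ?z' n \<xi> \<in> A then 1 / t else 1) \<partial>PiM {..<n} (\<lambda>_. std_gauss2))"
      using t by (intro PsiN_pair_bound[where a=a and b=b and D=D and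
            f = "\<lambda>w. if w \<in> A then t else 1" and f' = "\<lambda>w. if w \<in> A then 1 / t else 1"]
          a W W' pb) (auto simp: end0 simp flip: zero_prod_def)
    then show ?thesis
      by (simp add: integral_PsiN_two_valued[OF A] p_def)
  qed
  from bernoulli_affinity_bound[OF p01 p01 this]
  have "(p z - p ?z')\<^sup>2 \<le> 1 - exp (- real n * W\<^sup>2 / 2)" .
  also have "\<dots> \<le> real n / 2 * W\<^sup>2"
    using exp_ge_add_one_self[of "- real n * W\<^sup>2 / 2"] by simp
  finally have "sqrt ((p z - p ?z')\<^sup>2) \<le> sqrt (real n / 2 * W\<^sup>2)"
    by (rule real_sqrt_le_mono)
  then show "\<bar>measure (piN \<gamma> h gU n z) A - measure (piN \<gamma> h gU n ?z') A\<bar> \<le> sqrt (real n / 2) * W"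
    using W0 by (simp only: real_sqrt_mult real_sqrt_abs p_def[symmetric] abs_of_nonneg)
qed (auto simp: piN_def)

end

section \<open>The deterministic control\<close>

text \<open>Samples of the parabola \<open>j * (2 * N - j)\<close> at odd \<open>j\<close>; in the
  control below only the odd indices move the position.\<close>

lemma sum_odd_parabola:
  "(\<Sum>i<k. (2 * real i + 1) * (2 * N - (2 * real i + 1))) = 2 * N * (real k)\<^sup>2 - real k * (4 * (real k)\<^sup>2 - 1) / 3"
  by (induction k) (simp_all add: field_simps power2_eq_square)

context obabo
begin

section \<open>Bounds on the damping factor\<close>

lemma q_square_bound: "q\<^sup>2 * (1 + \<gamma> * h) \<le> 1"
proof -
  have "q\<^sup>2 * (1 + \<gamma> * h) \<le> exp (- (\<gamma> * h)) * exp (\<gamma> * h)"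
    unfolding q_square by (intro mult_left_mono exp_ge_add_one_self) simp
  then show ?thesis by (simp flip: exp_add)
qed

lemma sigma_square: "\<sigma>\<^sup>2 = 1 - q\<^sup>2"
  using q_pos q_less_1 by (simp add: \<sigma>_def power_le_one)

text \<open>With \<open>y = \<gamma> * h / 2\<close>, division by \<open>q = exp (- y)\<close> turns
  this into \<open>2 * y \<le> 2 * sinh y\<close>. The proof replaces \<open>exp y\<close> by its
  quadratic Taylor polynomial \<open>E\<close>.\<close>

lemma q_sinh_bound: "\<gamma> * h * q \<le> 1 - q\<^sup>2"
proof -
  define y where "y = \<gamma> * h / 2"
  have y: "0 \<le> y" using gamma_pos h_pos by (simp add: y_def)
  have q: "q * exp y = 1" by (simp add: q_def y_def flip: exp_add)
  define E where "E = 1 + y + y\<^sup>2 / 2"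
  have "E \<le> exp y" unfolding E_def using exp_lower_Taylor_quadratic[OF y] .
  then have qE: "q * E \<le> 1" using q q_pos by (metis mult_left_mono less_imp_le)
  have "1 \<le> E" using y by (simp add: E_def)
  \<comment> \<open>The product equals \<open>1 + y ^ 4 / 4\<close>.\<close>
  have "1 \<le> E * (E - 2 * y)"
    using y by (simp add: E_def field_simps power2_eq_square)
  then have "q\<^sup>2 * 1 \<le> q\<^sup>2 * (E * (E - 2 * y))" by (intro mult_left_mono) auto
  also have "\<dots> = (q * E) * (q * E) - 2 * y * q * (q * E)"
    by (simp add: algebra_simps power2_eq_square)
  \<comment> \<open>The function \<open>t\<^sup>2 - 2 * y * q * t\<close> is compared at
    \<open>t = q * E\<close> and \<open>t = 1\<close>; the difference of its values factors as
    \<open>(1 - t) * (1 + t - 2 * y * q)\<close>.\<close>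
  also have "\<dots> \<le> 1 - 2 * y * q"
  proof -
    have "0 \<le> (1 - q * E) * ((1 - 2 * y * q) + q * E)" if "2 * y * q \<le> 1"
      using qE that q_pos \<open>1 \<le> E\<close> by (intro mult_nonneg_nonneg) (auto simp: add_nonneg_nonneg)
    moreover have "2 * y * q \<le> 1"
    proof -
      have "2 * y \<le> E" using sum_squares_bound[of 1 y] zero_le_power2[of "1 - y"]
        by (simp add: E_def power2_diff power2_eq_square algebra_simps)
      then show ?thesis using qE q_pos
        by (smt (verit) mult.commute mult_right_mono)
    qed
    ultimately show ?thesis by (simp add: algebra_simps)
  qed
  finally show ?thesis by (simp add: y_def)
qed

text \<open>In the sequence \<open>b 0, D 0, b 1, D 1, \<dots>\<close> of velocity differences and scaled position
  increments, an unperturbed chain with \<open>gU = 0\<close> multiplies by \<open>q\<close> at each step. The damped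
  sequence \<open>q ^ j *\<^sub>R b0\<close> is brought to zero by a linear factor, and the position difference
  that remains is removed by a parabola; \<open>parab n\<close> normalises the latter.\<close>

definition parab :: "nat \<Rightarrow> real" where
  "parab n = 3 / (h * n * (2 * (real n)\<^sup>2 + 1))"

text \<open>The displacement after \<open>k\<close> steps caused by the damped part of the velocity,
  per unit of \<open>b0\<close>.\<close>

definition drift :: "nat \<Rightarrow> nat \<Rightarrow> real" where
  "drift n k = h * (\<Sum>i<k. q ^ (2 * i + 1) * (1 - (2 * real i + 1) / (2 * real n)))"

text \<open>The fraction of the remaining position difference that the parabola has removed after
  \<open>k\<close> steps.\<close>

definition lift :: "nat \<Rightarrow> nat \<Rightarrow> real" where
  "lift n k = h * parab n * (\<Sum>i<k. (2 * real i + 1) * (2 * real n - (2 * real i + 1)))"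

text \<open>The index counts half steps: \<open>2 * k\<close> is the velocity difference before step
  \<open>k\<close>, and \<open>2 * k + 1\<close> is the position increment of that step divided by
  \<open>h\<close>. The vector \<open>a0 + drift n n *\<^sub>R b0\<close> is the final position
  difference that the damped part alone would leave.\<close>

definition vel :: "nat \<Rightarrow> 'd \<Rightarrow> 'd \<Rightarrow> nat \<Rightarrow> 'd" where
  "vel n a0 b0 j = (q ^ j * (1 - real j / (2 * real n))) *\<^sub>R b0
     - (parab n * (real j * (2 * real n - real j))) *\<^sub>R (a0 + drift n n *\<^sub>R b0)"

definition pos :: "nat \<Rightarrow> 'd \<Rightarrow> 'd \<Rightarrow> nat \<Rightarrow> 'd" where
  "pos n a0 b0 k = a0 + h *\<^sub>R (\<Sum>i<k. vel n a0 b0 (2 * i + 1))"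

lemma pos_Suc: "pos n a0 b0 (Suc k) = pos n a0 b0 k + h *\<^sub>R vel n a0 b0 (2 * k + 1)"
  by (simp add: pos_def scaleR_add_right)

lemma pos_0: "pos n a0 b0 0 = a0"
  by (simp add: pos_def)

lemma vel_0: "vel n a0 b0 0 = b0"
  by (simp add: vel_def)

lemma vel_end: "n \<ge> 1 \<Longrightarrow> vel n a0 b0 (2 * n) = 0"
  by (simp add: vel_def)

lemma pos_eq:
  "pos n a0 b0 k = (1 - lift n k) *\<^sub>R a0 + (drift n k - lift n k * drift n n) *\<^sub>R b0"
proof -
  define S where "S = (\<Sum>i<k. q ^ (2 * i + 1) * (1 - (2 * real i + 1) / (2 * real n)))"
  define Q where "Q = (\<Sum>i<k. (2 * real i + 1) * (2 * real n - (2 * real i + 1)))"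
  have vel: "(\<Sum>i<k. vel n a0 b0 (2 * i + 1)) = S *\<^sub>R b0 - (parab n * Q) *\<^sub>R (a0 + drift n n *\<^sub>R b0)"
    by (simp add: vel_def S_def Q_def sum_subtractf scaleR_sum_left sum_distrib_left add.commute)
  show ?thesis
    unfolding pos_def vel drift_def[of n k] lift_def S_def[symmetric] Q_def[symmetric]
    by (simp add: algebra_simps)
qed

section \<open>Size of the controlled path\<close>

lemma drift_term_nonneg: "i < n \<Longrightarrow> 0 \<le> q ^ (2 * i + 1) * (1 - (2 * real i + 1) / (2 * real n))"
  using q_pos by (intro mult_nonneg_nonneg) (auto simp: field_simps)

lemma drift_mono: "k \<le> n \<Longrightarrow> drift n k \<le> drift n n"
  using h_pos unfolding drift_def
  by (intro mult_left_mono sum_mono2 drift_term_nonneg) auto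

lemma drift_nonneg: "k \<le> n \<Longrightarrow> 0 \<le> drift n k"
  using h_pos unfolding drift_def
  by (intro mult_nonneg_nonneg sum_nonneg drift_term_nonneg) auto

lemma lift_end: "n \<ge> 1 \<Longrightarrow> lift n n = 1"
proof -
  assume n: "n \<ge> 1"
  have "(\<Sum>i<n. (2 * real i + 1) * (2 * real n - (2 * real i + 1))) = real n * (2 * (real n)\<^sup>2 + 1) / 3"
    unfolding sum_odd_parabola by (simp add: field_simps power2_eq_square)
  moreover have "0 < 2 * (real n)\<^sup>2 + 1" by (simp add: add_nonneg_pos)
  ultimately show "lift n n = 1"
    using n h_pos by (simp add: lift_def parab_def)
qed

lemma parab_nonneg: "0 \<le> parab n"
  using h_pos by (simp add: parab_def)

lemma lift_nonneg: "k \<le> n \<Longrightarrow> 0 \<le> lift n k"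
  using h_pos parab_nonneg unfolding lift_def
  by (auto intro!: mult_nonneg_nonneg sum_nonneg)

lemma lift_le_1: "k \<le> n \<Longrightarrow> n \<ge> 1 \<Longrightarrow> lift n k \<le> 1"
  unfolding lift_end[symmetric] using h_pos parab_nonneg unfolding lift_def
  by (auto intro!: mult_left_mono sum_mono2)

lemma pos_end: "n \<ge> 1 \<Longrightarrow> pos n a0 b0 n = 0"
  by (simp add: pos_eq lift_end)

text \<open>In \<open>pos_eq\<close> the coefficient of \<open>a0\<close> lies between
  \<open>0\<close> and \<open>1\<close>, and that of \<open>b0\<close> is a difference of two
  numbers between \<open>0\<close> and \<open>drift n n\<close>.\<close>

lemma norm_pos_le:
  assumes "k \<le> n" "n \<ge> 1"
  shows "norm (pos n a0 b0 k) \<le> norm a0 + drift n n * norm b0"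
proof -
  note l = lift_nonneg[OF assms(1)] lift_le_1[OF assms]
  note d = drift_nonneg[OF assms(1)] drift_mono[OF assms(1)]
  have "0 \<le> lift n k * drift n n" "lift n k * drift n n \<le> drift n n"
    using l d by (auto intro: mult_left_le_one_le)
  then have "\<bar>drift n k - lift n k * drift n n\<bar> \<le> drift n n" using d by auto
  moreover have "\<bar>1 - lift n k\<bar> \<le> 1" using l by auto
  ultimately have "\<bar>1 - lift n k\<bar> * norm a0 + \<bar>drift n k - lift n k * drift n n\<bar> * norm b0
      \<le> 1 * norm a0 + drift n n * norm b0"
    by (intro add_mono mult_right_mono) auto
  then show ?thesis
    unfolding pos_eq using norm_triangle_ineq by (metis (no_types, lifting) mult_1 norm_scaleR order_trans)
qed

lemma drift_le: "drift n n \<le> h * n"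
proof -
  have "(\<Sum>i<n. q ^ (2 * i + 1) * (1 - (2 * real i + 1) / (2 * real n))) \<le> (\<Sum>i<n. 1)"
    using q_pos q_less_1
    by (intro sum_mono mult_le_one power_le_one) (auto simp: field_simps)
  then show ?thesis using h_pos by (simp add: drift_def)
qed

text \<open>Without the linear factor the sum is geometric and at most
  \<open>q / (1 - q\<^sup>2)\<close>, which \<open>q_sinh_bound\<close> controls. Together with
  \<open>drift_le\<close> this bounds the drift by the smaller of \<open>h * n\<close> and
  \<open>1 / \<gamma>\<close>, the source of the quotient
  \<open>h * n / (1 + \<gamma> * h * n)\<close> in the final bound.\<close>

lemma gamma_drift_le: "\<gamma> * drift n n \<le> 1"
proof -
  have q2: "q\<^sup>2 < 1" using q_pos q_less_1 by (simp add: power_less_one_iff)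
  have "(\<Sum>i<n. q ^ (2 * i + 1) * (1 - (2 * real i + 1) / (2 * real n))) \<le> (\<Sum>i<n. q * (q\<^sup>2) ^ i)"
    using q_pos
    by (intro sum_mono) (auto simp: power_mult power_add intro!: mult_left_le)
  also have "\<dots> = q * ((1 - (q\<^sup>2) ^ n) / (1 - q\<^sup>2))"
    using q2 by (simp add: sum_gp_strict flip: sum_distrib_left)
  also have "\<dots> \<le> q * (1 / (1 - q\<^sup>2))"
    using q_pos q2 by (intro mult_left_mono divide_right_mono) auto
  finally have "\<gamma> * drift n n \<le> \<gamma> * (h * (q * (1 / (1 - q\<^sup>2))))"
    unfolding drift_def using gamma_pos h_pos by (intro mult_left_mono) auto
  also have "\<dots> \<le> 1"
    using q_sinh_bound q2 by (simp add: field_simps)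
  finally show ?thesis .
qed

text \<open>The damping in the \<open>b0\<close> part cancels exactly, so only the slope
  \<open>1 / (2 * n)\<close> of its linear factor remains. The undamped parabola contributes its own
  increment and \<open>1 - q\<close> times its value.\<close>

lemma norm_vel_step_le:
  assumes n: "n \<ge> 1" and j: "j < 2 * n"
  shows "norm (vel n a0 b0 (Suc j) - q *\<^sub>R vel n a0 b0 j)
    \<le> q / (2 * n) * norm b0
      + (3 * h / (h * n)\<^sup>2 + (1 - q) * (3 / (2 * (h * n)))) * (norm a0 + drift n n * norm b0)"
proof -
  define e where "e = a0 + drift n n *\<^sub>R b0"
  have e: "norm e \<le> norm a0 + drift n n * norm b0"
    using drift_nonneg[of n n] norm_triangle_ineq[of a0 "drift n n *\<^sub>R b0"] by (simp add: e_def)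
  \<comment> \<open>\<open>B\<close> is the increment of the parabola \<open>j * (2 * n - j)\<close>
    from \<open>j\<close> to \<open>j + 1\<close>, and \<open>C\<close> is its value at
    \<open>j\<close>.\<close>
  define B where "B = 2 * real n - 2 * real j - 1"
  define C where "C = real j * (2 * real n - real j)"
  have "\<bar>B\<bar> \<le> 2 * n" using j by (auto simp: B_def abs_le_iff)
  have C: "0 \<le> C" "C \<le> (real n)\<^sup>2"
    using j zero_le_power2[of "real n - real j"]
    by (auto simp: C_def power2_eq_square algebra_simps mult_left_mono)
  have par: "parab n \<le> 3 / (2 * h * real n ^ 3)"
    unfolding parab_def using n h_pos
    by (intro divide_left_mono) (auto simp: power2_eq_square power3_eq_cube algebra_simps add_pos_pos)
  have "parab n * \<bar>B\<bar> \<le> 3 / (2 * h * real n ^ 3) * (2 * n)"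
    using par \<open>\<bar>B\<bar> \<le> 2 * n\<close> h_pos by (intro mult_mono) auto
  also have "\<dots> = 3 * h / (h * n)\<^sup>2"
    using n h_pos by (simp add: field_simps power2_eq_square power3_eq_cube)
  finally have pB: "parab n * \<bar>B\<bar> \<le> 3 * h / (h * n)\<^sup>2" .
  have "parab n * C \<le> 3 / (2 * h * real n ^ 3) * (real n)\<^sup>2"
    using par C h_pos by (intro mult_mono) auto
  also have "\<dots> = 3 / (2 * (h * n))"
    using n h_pos by (simp add: field_simps power2_eq_square power3_eq_cube)
  finally have pC: "parab n * C \<le> 3 / (2 * (h * n))" .
  have "vel n a0 b0 (Suc j) - q *\<^sub>R vel n a0 b0 j
      = (- (q ^ Suc j / (2 * n))) *\<^sub>R b0 - (parab n * B + (1 - q) * (parab n * C)) *\<^sub>R e"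
  proof -
    have "q ^ Suc j * (1 - real (Suc j) / (2 * n)) - q * (q ^ j * (1 - real j / (2 * n)))
        = - (q ^ Suc j / (2 * n))"
      using n by (simp add: field_simps)
    moreover have "parab n * (real (Suc j) * (2 * real n - real (Suc j))) - q * (parab n * C)
        = parab n * B + (1 - q) * (parab n * C)"
      by (simp add: B_def C_def algebra_simps)
    moreover have "(s *\<^sub>R b0 - t *\<^sub>R e) - q *\<^sub>R (s' *\<^sub>R b0 - t' *\<^sub>R e)
        = (s - q * s') *\<^sub>R b0 - (t - q * t') *\<^sub>R e" for s s' t t'
      by (simp add: algebra_simps)
    ultimately show ?thesis
      unfolding vel_def e_def[symmetric] C_def[symmetric] by simp
  qed
  also have "norm \<dots> \<le> q ^ Suc j / (2 * n) * norm b0 + \<bar>parab n * B + (1 - q) * (parab n * C)\<bar> * norm e"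
    by (rule order_trans[OF norm_triangle_ineq4]) (use q_pos in simp)
  also have "\<dots> \<le> q / (2 * n) * norm b0
      + (3 * h / (h * n)\<^sup>2 + (1 - q) * (3 / (2 * (h * n)))) * (norm a0 + drift n n * norm b0)"
  proof (intro add_mono mult_mono)
    show "q ^ Suc j / (2 * n) \<le> q / (2 * n)"
      using q_pos q_less_1 by (intro divide_right_mono) (auto intro: mult_left_le power_le_one)
    have "\<bar>parab n * B + (1 - q) * (parab n * C)\<bar> \<le> parab n * \<bar>B\<bar> + (1 - q) * (parab n * C)"
      using q_less_1 C parab_nonneg[of n] by (auto intro!: order_trans[OF abs_triangle_ineq] simp: abs_mult)
    also have "\<dots> \<le> 3 * h / (h * n)\<^sup>2 + (1 - q) * (3 / (2 * (h * n)))"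
      using q_less_1 pB pC by (intro add_mono mult_left_mono) auto
    finally show "\<bar>parab n * B + (1 - q) * (parab n * C)\<bar>
      \<le> 3 * h / (h * n)\<^sup>2 + (1 - q) * (3 / (2 * (h * n)))" .
    show "0 \<le> 3 * h / (h * n)\<^sup>2 + (1 - q) * (3 / (2 * (h * n)))"
      using h_pos q_less_1 by (intro add_nonneg_nonneg mult_nonneg_nonneg) auto
  qed (use e q_pos in auto)
  finally show ?thesis .
qed

text \<open>The path \<open>pos\<close>, \<open>vel\<close> is used as the control. The factor
  \<open>1 + drift n n\<close> comes from bounding both \<open>norm a0\<close> and
  \<open>norm b0\<close> by \<open>norm (z' - z)\<close>.\<close>

lemma dTV_piN_le_explicit:
  assumes n: "n \<ge> 1" and lip: "L-lipschitz_on UNIV gU"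
  shows "dTV (piN \<gamma> h gU n z) (piN \<gamma> h gU n z') \<le> sqrt (real n / 2) / \<sigma>
    * (q / (2 * n) + (3 * h / (h * n)\<^sup>2 + (1 - q) * (3 / (2 * (h * n))) + h / 2 * L) * (1 + drift n n))
    * norm (z' - z)"
proof -
  define R where "R = norm (z' - z)"
  define a0 b0 where "a0 = fst (z' - z)" and "b0 = snd (z' - z)"
  have ab: "norm a0 \<le> R" "norm b0 \<le> R"
    unfolding a0_def b0_def R_def by (metis norm_fst_le norm_snd_le prod.collapse)+
  have z': "z' = z + (a0, b0)" by (simp add: a0_def b0_def prod_eq_iff)
  have L: "0 \<le> L" using lip by (rule lipschitz_on_nonneg)
  have d: "0 \<le> drift n n" using drift_nonneg by simp
  define K where "K = 3 * h / (h * n)\<^sup>2 + (1 - q) * (3 / (2 * (h * n)))"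
  have K: "0 \<le> K"
    unfolding K_def using h_pos q_less_1 by (intro add_nonneg_nonneg mult_nonneg_nonneg) auto
  define M where "M = (1 + drift n n) * R"
  have M: "norm a0 + drift n n * norm b0 \<le> M"
    unfolding M_def distrib_right using ab d by (intro add_mono mult_left_mono) auto
  \<comment> \<open>\<open>M\<close> bounds the position difference at all times, and
    \<open>V\<close> bounds \<open>\<sigma>\<close> times every noise shift, so the control has
    \<open>W = V / \<sigma>\<close>.\<close>
  define V where "V = q / (2 * n) * R + K * M + h / 2 * (L * M)"
  have vel: "norm (vel n a0 b0 (Suc j) - q *\<^sub>R vel n a0 b0 j) \<le> q / (2 * n) * R + K * M"
    if "j < 2 * n" for j
    using norm_vel_step_le[OF n that, of a0 b0] ab K M q_pos unfolding K_def[symmetric]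
    by (elim order_trans) (intro add_mono mult_left_mono; simp)
  have grad: "norm (gU (x + pos n a0 b0 k) - gU x) \<le> L * M" if "k \<le> n" for x k
  proof -
    have "norm (gU (x + pos n a0 b0 k) - gU x) \<le> L * norm (pos n a0 b0 k)"
      using lipschitz_onD[OF lip, of "x + pos n a0 b0 k" x] by (simp add: dist_norm)
    also have "\<dots> \<le> L * M"
      using norm_pos_le[OF that n, of a0 b0] M L by (intro mult_left_mono) auto
    finally show ?thesis .
  qed
  \<comment> \<open>The coefficient \<open>c\<close> covers both gradient corrections of a step,
    \<open>h / 2\<close> for the first noise and \<open>h / 2 * q\<close> for the second.\<close>
  have V: "norm (vel n a0 b0 (Suc j) - q *\<^sub>R vel n a0 b0 j + c *\<^sub>R (gU (x + pos n a0 b0 k) - gU x)) \<le> V"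
    if "j < 2 * n" "k \<le> n" "0 \<le> c" "c \<le> h / 2" for j k x c
  proof -
    have "c * norm (gU (x + pos n a0 b0 k) - gU x) \<le> h / 2 * (L * M)"
      using grad[OF that(2), of x] that h_pos by (intro mult_mono) auto
    then have "norm (c *\<^sub>R (gU (x + pos n a0 b0 k) - gU x)) \<le> h / 2 * (L * M)"
      using that by simp
    then show ?thesis
      unfolding V_def using vel[OF that(1)] by (intro norm_triangle_le add_mono) auto
  qed
  have V0: "0 \<le> V"
    using V[of 0 0 0 0] n h_pos by (intro order_trans[OF norm_ge_zero]) auto
  have "dTV (piN \<gamma> h gU n z) (piN \<gamma> h gU n (z + (pos n a0 b0 0, vel n a0 b0 (2 * 0))))
      \<le> sqrt (real n / 2) * (V / \<sigma>)"
  proof (rule dTV_piN_le[where D="\<lambda>k. vel n a0 b0 (2 * k + 1)"])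
    fix k x assume k: "k < n"
    show "norm (vel n a0 b0 (2 * k + 1) - q *\<^sub>R vel n a0 b0 (2 * k)
        + (h / 2) *\<^sub>R (gU (x + pos n a0 b0 k) - gU x)) \<le> \<sigma> * (V / \<sigma>)"
      using V[of "2 * k" k "h / 2" x] k h_pos sigma_pos by simp
    show "norm (vel n a0 b0 (2 * Suc k) - q *\<^sub>R vel n a0 b0 (2 * k + 1)
        + (h / 2 * q) *\<^sub>R (gU (x + pos n a0 b0 (Suc k)) - gU x)) \<le> \<sigma> * (V / \<sigma>)"
      using V[of "2 * k + 1" "Suc k" "h / 2 * q" x] k h_pos sigma_pos q_pos q_less_1 by simp
  qed (use n V0 sigma_pos in \<open>simp_all add: pos_Suc pos_end vel_end\<close>)
  moreover have "V = (q / (2 * n) + (K + h / 2 * L) * (1 + drift n n)) * R"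
    by (simp add: V_def M_def algebra_simps)
  ultimately show ?thesis
    unfolding pos_0 vel_0 mult_0_right z'[symmetric] K_def R_def by simp
qed

section \<open>Explicit cost of the control\<close>

text \<open>The product splits into four terms, from the linear factor, the increment of the
  parabola, its value, and the gradient. Each is estimated by comparing \<open>\<sigma>\<close> with
  \<open>sqrt (\<gamma> * h)\<close>; writing everything in the square roots \<open>X\<close>,
  \<open>G\<close>, \<open>H\<close> makes the terms rational.\<close>

lemma control_cost_le:
  assumes n: "n \<ge> 1" and L: "0 \<le> L"
  shows "sqrt (real n / 2) / \<sigma>
    * (q / (2 * n) + (3 * h / (h * n)\<^sup>2 + (1 - q) * (3 / (2 * (h * n))) + h / 2 * L) * (1 + drift n n))
    \<le> 1 / sqrt \<gamma> * (5 / (h * n) powr (3/2) + (12 + 5 * \<gamma>) / sqrt (h * n)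
        + L * sqrt (\<gamma> * h) / \<sigma> * (1 + h * n / (1 + \<gamma> * h * n)) * sqrt (h * n))"
proof -
  define X G H where "X = sqrt (h * n)" and "G = sqrt \<gamma>" and "H = sqrt h"
  define s where "s = drift n n"
  have pos: "0 < X" "0 < G" "0 < H"
    using n h_pos gamma_pos by (simp_all add: X_def G_def H_def)
  have "h * n = X\<^sup>2" using h_pos unfolding X_def by (subst real_sqrt_pow2) auto
  then have sq: "h * n = X\<^sup>2" "\<gamma> = G\<^sup>2" "h = H\<^sup>2" "sqrt (\<gamma> * h) = G * H" "sqrt \<gamma> = G"
    using n h_pos gamma_pos by (simp_all add: G_def H_def real_sqrt_mult)
  have nX: "real n = X\<^sup>2 / H\<^sup>2" using h_pos by (simp flip: sq(1-3))
  have powr: "(h * n) powr (3/2) = X ^ 3"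
  proof -
    have "(h * n) powr (3/2) = (h * n) * (h * n) powr (1/2)"
      using n h_pos powr_add[of "h * n" 1 "1/2"] by simp
    then show ?thesis
      using n h_pos by (simp add: powr_half_sqrt X_def power3_eq_cube)
  qed
  have s: "0 \<le> s" "s \<le> X\<^sup>2" "G\<^sup>2 * s \<le> 1"
    using drift_nonneg[of n n] drift_le[of n] gamma_drift_le[of n] by (simp_all add: s_def flip: sq(1-3))
  have qGH: "q * H * G \<le> \<sigma>"
  proof (rule power2_le_imp_le)
    show "(q * H * G)\<^sup>2 \<le> \<sigma>\<^sup>2"
      using q_square_bound by (simp add: sigma_square power_mult_distrib algebra_simps flip: sq(1-3))
  qed (use sigma_pos in simp)
  \<comment> \<open>For large \<open>\<gamma> * h\<close> the root \<open>H * G\<close> exceeds any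
    multiple of \<open>\<sigma>\<close>, which stays below \<open>1\<close>; the additional factor
    is at least \<open>sqrt (1 + \<gamma> * h)\<close> and compensates.\<close>
  have GHs: "H * G \<le> \<sigma> * (1 + G\<^sup>2 * X\<^sup>2)"
  proof (rule power2_le_imp_le)
    have "(H * G)\<^sup>2 \<le> (1 - q\<^sup>2) * (1 + \<gamma> * h)"
      using q_square_bound by (simp add: power_mult_distrib algebra_simps flip: sq(1-3))
    also have "\<dots> \<le> (1 - q\<^sup>2) * (1 + \<gamma> * (h * n))\<^sup>2"
    proof (rule mult_left_mono)
      have "1 + \<gamma> * h \<le> 1 + \<gamma> * (h * n)" using n gamma_pos h_pos by simp
      also have "\<dots> \<le> (1 + \<gamma> * (h * n))\<^sup>2"
        using gamma_pos h_pos by (intro self_le_power) auto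
      finally show "1 + \<gamma> * h \<le> (1 + \<gamma> * (h * n))\<^sup>2" .
    qed (use sigma_square in \<open>metis zero_le_power2\<close>)
    also have "\<dots> = (\<sigma> * (1 + G\<^sup>2 * X\<^sup>2))\<^sup>2"
      by (simp add: power_mult_distrib sigma_square flip: sq(1-3))
    finally show "(H * G)\<^sup>2 \<le> (\<sigma> * (1 + G\<^sup>2 * X\<^sup>2))\<^sup>2" .
  qed (use sigma_pos in simp)
  \<comment> \<open>As \<open>\<sigma>\<^sup>2 = (1 - q) * (1 + q)\<close>, one factor
    \<open>1 - q\<close> cancels after squaring and \<open>1 - q \<le> \<gamma> * h\<close>
    suffices.\<close>
  have q1: "1 - q \<le> \<sigma> * H * G"
  proof (rule power2_le_imp_le)
    have "1 - q \<le> \<gamma> * h"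
      using exp_ge_add_one_self[of "- (\<gamma> * h) / 2"] gamma_pos h_pos mult_pos_pos[of \<gamma> h]
      unfolding q_def by linarith
    also have "\<dots> \<le> (1 + q) * (\<gamma> * h)"
      using gamma_pos h_pos q_pos by simp
    finally have "(1 - q) * (1 - q) \<le> (1 - q) * ((1 + q) * (\<gamma> * h))"
      using q_less_1 by (intro mult_left_mono) auto
    moreover have "(\<sigma> * H * G)\<^sup>2 = (1 - q\<^sup>2) * (\<gamma> * h)"
      by (simp add: power_mult_distrib sigma_square flip: sq(1-3))
    ultimately show "(1 - q)\<^sup>2 \<le> (\<sigma> * H * G)\<^sup>2"
      by (simp add: power2_eq_square algebra_simps)
  qed (use sigma_pos pos in simp)
  have "sqrt (real n / 2) \<le> sqrt (real n)" by simp
  also have "\<dots> = X / H" using pos by (simp add: nX real_sqrt_divide)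
  finally have sqrt_n: "sqrt (real n / 2) \<le> X / H" .
  have t1: "X / H / \<sigma> * (q / (2 * n)) \<le> 1 / G * (1 / (2 * X))"
  proof -
    have "X / H / \<sigma> * (q / (2 * n)) = (q * H * G) / \<sigma> * (1 / G * (1 / (2 * X)))"
      using pos by (simp add: nX power2_eq_square)
    also have "\<dots> \<le> 1 * (1 / G * (1 / (2 * X)))"
      using qGH sigma_pos pos by (intro mult_right_mono) auto
    finally show ?thesis by simp
  qed
  have t2: "X / H / \<sigma> * (3 * h / (h * n)\<^sup>2) * (1 + s) \<le> 1 / G * (3 * (1 / X ^ 3 + G\<^sup>2 / X + 2 / X))"
  proof -
    have "X / H / \<sigma> * (3 * h / (h * n)\<^sup>2) * (1 + s) = (H * G) / \<sigma> * (1 / G * (3 / X ^ 3 * (1 + s)))"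
    proof -
      have "3 * h / (h * n)\<^sup>2 = 3 * H\<^sup>2 / (X\<^sup>2)\<^sup>2"
        by (simp only: sq(1)) (simp flip: sq(3))
      then show ?thesis
        using pos by (simp add: power2_eq_square power3_eq_cube)
    qed
    also have "\<dots> \<le> (1 + G\<^sup>2 * X\<^sup>2) * (1 / G * (3 / X ^ 3 * (1 + s)))"
      using GHs sigma_pos pos s by (intro mult_right_mono) (auto simp: field_simps)
    also have "\<dots> = 1 / G * (3 / X ^ 3 * ((1 + G\<^sup>2 * X\<^sup>2) * (1 + s)))"
      by (simp only: mult_ac)
    \<comment> \<open>The product is grouped so that \<open>s \<le> X\<^sup>2\<close> applies to the
      lone \<open>s\<close> and \<open>G\<^sup>2 * s \<le> 1\<close> to the mixed term.\<close>
    also have "\<dots> = 1 / G * (3 / X ^ 3 * (1 + G\<^sup>2 * X\<^sup>2 + (s + X\<^sup>2 * (G\<^sup>2 * s))))"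
      by (simp only: distrib_left distrib_right mult_1 mult_1_right mult_ac add_ac)
    also have "\<dots> \<le> 1 / G * (3 / X ^ 3 * (1 + G\<^sup>2 * X\<^sup>2 + (X\<^sup>2 + X\<^sup>2 * 1)))"
      using s pos by (intro mult_left_mono add_mono order_refl) auto
    also have "\<dots> = 1 / G * (3 * (1 / X ^ 3 + G\<^sup>2 / X + 2 / X))"
      using pos by (simp add: field_simps power2_eq_square power3_eq_cube)
    finally show ?thesis .
  qed
  have t3: "X / H / \<sigma> * ((1 - q) * (3 / (2 * (h * n)))) * (1 + s) \<le> 1 / G * (3 / 2 * (G\<^sup>2 / X + 1 / X))"
  proof -
    have "X / H / \<sigma> * ((1 - q) * (3 / (2 * (h * n)))) * (1 + s)
        = (1 - q) / (\<sigma> * H * G) * (1 / G * (3 / (2 * X) * (G\<^sup>2 + G\<^sup>2 * s)))"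
      using pos sigma_pos unfolding sq(1) by (simp add: field_simps power2_eq_square)
    also have "\<dots> \<le> 1 * (1 / G * (3 / (2 * X) * (G\<^sup>2 + 1)))"
      using q1 q_less_1 sigma_pos pos s by (intro mult_mono mult_left_mono) auto
    also have "\<dots> = 1 / G * (3 / 2 * (G\<^sup>2 / X + 1 / X))"
      using pos by (simp add: field_simps)
    finally show ?thesis .
  qed
  have t4: "X / H / \<sigma> * (h / 2 * L) * (1 + s)
      \<le> 1 / G * (L * (G * H) / \<sigma> * (1 + X\<^sup>2 / (1 + G\<^sup>2 * X\<^sup>2)) * X)"
  proof -
    have den: "0 < 1 + G\<^sup>2 * X\<^sup>2" by (simp add: add_pos_nonneg)
    \<comment> \<open>Both drift bounds combine into one quotient at the price of a factor
      \<open>2\<close>, which the \<open>1 / 2\<close> of the gradient coefficient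
      \<open>h / 2\<close> absorbs.\<close>
    have "s * (1 + G\<^sup>2 * X\<^sup>2) = s + X\<^sup>2 * (G\<^sup>2 * s)" by (simp add: algebra_simps)
    also have "\<dots> \<le> X\<^sup>2 + X\<^sup>2 * 1" using s by (intro add_mono mult_left_mono) auto
    finally have "s \<le> 2 * (X\<^sup>2 / (1 + G\<^sup>2 * X\<^sup>2))" using den by (simp add: field_simps)
    moreover have "s \<le> 2 * r \<Longrightarrow> (1 + s) / 2 \<le> 1 + r" for r by simp
    ultimately have s': "(1 + s) / 2 \<le> 1 + X\<^sup>2 / (1 + G\<^sup>2 * X\<^sup>2)" by blast
    have hH: "h / H = H" by (simp add: H_def real_div_sqrt h_pos less_imp_le)
    have "X / H / \<sigma> * (h / 2 * L) * (1 + s) = h / H * (L * X / \<sigma> * ((1 + s) / 2))"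
      by (simp add: mult_ac)
    also have "\<dots> = L * H * X / \<sigma> * ((1 + s) / 2)"
      unfolding hH by simp
    also have "\<dots> \<le> L * H * X / \<sigma> * (1 + X\<^sup>2 / (1 + G\<^sup>2 * X\<^sup>2))"
      using s' L pos sigma_pos by (intro mult_left_mono) auto
    finally show ?thesis using pos by (simp add: mult_ac)
  qed
  \<comment> \<open>The constants add up as \<open>8 = 1/2 + 6 + 3/2\<close> and
    \<open>9/2 = 3 + 3/2\<close>; with the \<open>3\<close> of \<open>1 / X ^ 3\<close> they stay
    below the stated \<open>12\<close>, \<open>5\<close> and \<open>5\<close>.\<close>
  have collect: "1 / G * (1 / (2 * X)) + 1 / G * (3 * (1 / X ^ 3 + G\<^sup>2 / X + 2 / X))
      + 1 / G * (3 / 2 * (G\<^sup>2 / X + 1 / X)) + 1 / G * r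
    = 1 / G * (3 * (1 / X ^ 3) + (8 * (1 / X) + 9 / 2 * (G\<^sup>2 / X)) + r)" for r
    using pos by (simp add: field_simps)
  define Y where "Y = q / (2 * n) + (3 * h / (h * n)\<^sup>2 + (1 - q) * (3 / (2 * (h * n))) + h / 2 * L) * (1 + s)"
  have "0 \<le> Y"
    unfolding Y_def using q_pos q_less_1 h_pos L s
    by (intro add_nonneg_nonneg mult_nonneg_nonneg) auto
  then have "sqrt (real n / 2) / \<sigma> * Y \<le> X / H / \<sigma> * Y"
    using sqrt_n sigma_pos by (intro mult_right_mono divide_right_mono) auto
  also have "\<dots> = X / H / \<sigma> * (q / (2 * n)) + X / H / \<sigma> * (3 * h / (h * n)\<^sup>2) * (1 + s)
      + X / H / \<sigma> * ((1 - q) * (3 / (2 * (h * n)))) * (1 + s) + X / H / \<sigma> * (h / 2 * L) * (1 + s)"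
    unfolding Y_def by (simp only: distrib_left distrib_right add.assoc mult.assoc)
  also have "\<dots> \<le> 1 / G * (1 / (2 * X)) + 1 / G * (3 * (1 / X ^ 3 + G\<^sup>2 / X + 2 / X))
      + 1 / G * (3 / 2 * (G\<^sup>2 / X + 1 / X))
      + 1 / G * (L * (G * H) / \<sigma> * (1 + X\<^sup>2 / (1 + G\<^sup>2 * X\<^sup>2)) * X)"
    using t1 t2 t3 t4 by (intro add_mono)
  also have "\<dots> = 1 / G * (3 * (1 / X ^ 3) + (8 * (1 / X) + 9 / 2 * (G\<^sup>2 / X))
      + L * (G * H) / \<sigma> * (1 + X\<^sup>2 / (1 + G\<^sup>2 * X\<^sup>2)) * X)"
    by (rule collect)
  also have "\<dots> \<le> 1 / G * (5 * (1 / X ^ 3) + (12 * (1 / X) + 5 * (G\<^sup>2 / X))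
      + L * (G * H) / \<sigma> * (1 + X\<^sup>2 / (1 + G\<^sup>2 * X\<^sup>2)) * X)"
    using pos by (intro mult_left_mono add_mono mult_right_mono order_refl) auto
  also have "\<dots> = 1 / sqrt \<gamma> * (5 / (h * n) powr (3/2) + (12 + 5 * \<gamma>) / sqrt (h * n)
        + L * sqrt (\<gamma> * h) / \<sigma> * (1 + h * n / (1 + \<gamma> * h * n)) * sqrt (h * n))"
    unfolding powr sq(4,5) mult.assoc[of \<gamma> h] X_def[symmetric]
    unfolding sq(1) by (simp add: add_divide_distrib flip: sq(2))
  finally show ?thesis unfolding Y_def s_def .
qed

end

theorem mainTheorem1:
  fixes U :: "'d::euclidean_space \<Rightarrow> real" and gU :: "'d \<Rightarrow> 'd"
    and gU' :: "'d \<Rightarrow> 'd \<Rightarrow>\<^sub>L 'd"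
    and \<gamma> h L :: real and n :: nat and z z' :: "'d \<times> 'd"
  assumes "\<gamma> > 0" and "h > 0" and "n \<ge> 1"
    and grad: "\<And>x. (U has_derivative (\<lambda>y. gU x \<bullet> y)) (at x)"
    and hess: "\<And>x. (gU has_derivative blinfun_apply (gU' x)) (at x)"
    and hess_cont: "continuous_on UNIV gU'"
    and lip: "L-lipschitz_on UNIV gU"
  shows "dTV (piN \<gamma> h gU n z) (piN \<gamma> h gU n z')
    \<le> 1 / sqrt \<gamma> *
       (5 / (h * n) powr (3/2) + (12 + 5 * \<gamma>) / sqrt (h * n)
        + L * sqrt (\<gamma> * h) / sqrt (1 - exp (- \<gamma> * h))
            * (1 + h * n / (1 + \<gamma> * h * n)) * sqrt (h * n))
      * norm (z' - z)"
proof -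
  interpret obabo \<gamma> h gU
    using assms(1,2) lipschitz_on_continuous_on[OF lip] by unfold_locales
  have \<sigma>: "\<sigma> = sqrt (1 - exp (- \<gamma> * h))"
    by (simp add: \<sigma>_def q_square)
  show ?thesis
    using order_trans[OF dTV_piN_le_explicit[OF assms(3) lip, of z z']
        mult_right_mono[OF control_cost_le[OF assms(3) lipschitz_on_nonneg[OF lip]] norm_ge_zero]]
    unfolding \<sigma> .
qed

end
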